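(* For all $0\leq r\leq \frac{m}{2}-1$ (with $m,r$ integers), we have $$S_{m,r}=T_{m-1-r,r}=U_{m-1-r,r}=V_{m-1-r,r}=W_{m-1-r,r}.$$
   Context: The five sums are defined by $$S_{n,r}=\sum_{i=r+1}^{\lfloor n/2\rfloor}\binom{n}{2i}\binom{i-1}{r},\qquad T_{n,r}=\sum_{j=r+1}^{n}\binom{n}{j}\binom{j-1}{r},\qquad U_{n,r}=\sum_{j=r+1}^{n}\binom{j-1}{r}2^{j-1-r},$$ $$V_{n,r}=\sum_{j=1}^{n-r}\binom{n-1-j}{r-1}2^{n-r-j}\left(2^{j}-1\right),\qquad W_{n,r}=2^{n-r}\sum_{k=0}^{\lfloor r/2\rfloor}\binom{n-2-2k}{r-2k}+(-1)^{r+1}.$$ *)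

theory Defs
  imports Complex_Main
begin

text \<open>
  Binomial coefficients with arbitrary integer arguments. For a nonnegative lower index this is the
  usual polynomial convention (so \<open>ibinom (-1) 0 = 1\<close>); a negative lower index is reduced to this case
  by the symmetry \<open>binom(n, k) = binom(n, n - k)\<close>, and the coefficient is 0 if both \<open>k\<close> and
  \<open>n - k\<close> are negative. In particular \<open>ibinom n (-1) = 0\<close> for \<open>n \<ge> 0\<close>, but \<open>ibinom (-1) (-1) = 1\<close>.
  The last value is the only nonzero coefficient in \<open>V_sum n 0\<close> (at \<open>j = n\<close>).
\<close>

definition ibinom :: "int \<Rightarrow> int \<Rightarrow> real" where
  "ibinom n k =
     (if k \<ge> 0 then real_of_int n gchoose nat k
      else if k \<le> n then real_of_int n gchoose nat (n - k)
      else 0)"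

definition S_sum :: "int \<Rightarrow> int \<Rightarrow> real" where
  "S_sum n r = (\<Sum>i = r + 1..\<lfloor>real_of_int n / 2\<rfloor>. ibinom n (2 * i) * ibinom (i - 1) r)"

definition T_sum :: "int \<Rightarrow> int \<Rightarrow> real" where
  "T_sum n r = (\<Sum>j = r + 1..n. ibinom n j * ibinom (j - 1) r)"

definition U_sum :: "int \<Rightarrow> int \<Rightarrow> real" where
  "U_sum n r = (\<Sum>j = r + 1..n. ibinom (j - 1) r * 2 powi (j - 1 - r))"

definition V_sum :: "int \<Rightarrow> int \<Rightarrow> real" where
  "V_sum n r = (\<Sum>j = 1..n - r. ibinom (n - 1 - j) (r - 1) * 2 powi (n - r - j) * (2 powi j - 1))"

definition W_sum :: "int \<Rightarrow> int \<Rightarrow> real" where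
  "W_sum n r =
     2 powi (n - r) * (\<Sum>k = 0..\<lfloor>real_of_int r / 2\<rfloor>. ibinom (n - 2 - 2 * k) (r - 2 * k))
     + (- 1) powi (r + 1)"

end

theory Submission
  imports Defs
begin

text \<open>
  The sums \<open>S\<close>, \<open>T\<close> and \<open>V\<close> are shown to equal \<open>U\<close> by checking that they have the same increments in
  the upper index. For \<open>T\<close> the increment is the subset-of-a-subset identity. For \<open>S\<close> it is
  Moriarty's identity \<open>\<Sum>i. binom(p + 1, 2 i + 1) binom(i, r) = binom(p - r, r) 2^(p - 2 r)\<close>: by
  Pascal's rule both sides \<open>A p r\<close> satisfy \<open>A (p + 2) (r + 1) = 2 A (p + 1) (r + 1) + A p r\<close>.
  For \<open>W\<close>, induction on \<open>r\<close> works instead, because \<open>U n (r + 1) + U n r = binom(n, r + 1) 2^(n - r - 1)\<close>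
  and the sums of binomial coefficients in \<open>W\<close> obey the matching recurrence.
\<close>

section \<open>Subset-of-a-subset sums and the increments of \<open>T\<close>\<close>

text \<open>Double counting of a \<open>k\<close>-set inside an \<open>i\<close>-set: fix the
  \<open>k\<close>-set first, then extend it freely by the other \<open>n - k\<close>
  elements.\<close>

lemma sum_choose_mult_choose:
  "(\<Sum>i\<le>n. (n choose i) * (i choose k)) = (n choose k) * 2 ^ (n - k)"
proof (cases "k \<le> n")
  case True
  have "(\<Sum>i\<le>n. (n choose i) * (i choose k)) = (\<Sum>i=k..n. (n choose i) * (i choose k))"
    by (rule sum.mono_neutral_right) auto
  also have "\<dots> = (\<Sum>i=k..n. (n choose k) * ((n - k) choose (i - k)))"
    by (intro sum.cong refl choose_mult) auto
  also have "\<dots> = (n choose k) * (\<Sum>i\<le>n - k. (n - k) choose i)"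
    unfolding sum_distrib_left[symmetric] using True
    by (intro arg_cong[where f = "(*) (n choose k)"]
        sum.reindex_bij_witness[where i = "\<lambda>i. i + k" and j = "\<lambda>i. i - k"]) auto
  finally show ?thesis
    by (simp add: choose_row_sum)
qed (simp add: binomial_eq_0)

lemma sum_choose_Suc_mult_choose:
  "(\<Sum>i<n. (n choose Suc i) * (i choose r)) = (\<Sum>i<n. (i choose r) * 2 ^ (i - r))"
proof (induction n)
  case (Suc n)
  have "(\<Sum>i<Suc n. (Suc n choose Suc i) * (i choose r)) =
      (\<Sum>i<Suc n. (n choose Suc i) * (i choose r)) + (\<Sum>i\<le>n. (n choose i) * (i choose r))"
    by (simp add: lessThan_Suc_atMost sum.distrib[symmetric] algebra_simps)
  then show ?case
    by (simp add: Suc sum_choose_mult_choose del: binomial_Suc_Suc)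
qed simp

section \<open>Moriarty's identity and the increments of \<open>S\<close>\<close>

text \<open>The bound \<open>p < 2 * N\<close> lets the sum reach every nonzero term. For
  \<open>p < 2 * r\<close> both sides are 0, so the truncated subtractions do no harm.\<close>

lemma sum_choose_odd_mult_choose:
  assumes "p < 2 * N"
  shows "(\<Sum>i<N. (Suc p choose Suc (2 * i)) * (i choose r)) = ((p - r) choose r) * 2 ^ (p - 2 * r)"
  using assms
proof (induction p arbitrary: r N rule: induct_nat_012)
  case 0
  then obtain M where "N = Suc M"
    by (cases N) auto
  then show ?case
    by (cases r) (auto simp: sum.lessThan_Suc_shift simp del: sum.lessThan_Suc)
next
  case 1
  then obtain M where "N = Suc M"
    by (cases N) auto
  then show ?case
    by (cases r) (auto simp: sum.lessThan_Suc_shift simp del: sum.lessThan_Suc)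
next
  case (ge2 p)
  define A where "A p r = (\<Sum>i<N. (Suc p choose Suc (2 * i)) * (i choose r))" for p r
  \<comment> \<open>Pascal's rule turns odd lower indices into even ones, so the recurrence for
    \<open>A\<close> passes through this companion.\<close>
  define B where "B p r = (\<Sum>i<N. (Suc p choose (2 * i)) * (i choose r))" for p r
  obtain M where M: "N = Suc M" "p < 2 * M"
    using ge2.prems by (cases N) auto
  \<comment> \<open>The term at \<open>i = M\<close> is 0 because \<open>p < 2 * M\<close>; this
    makes room for the index shift in \<open>BA\<close>.\<close>
  have *: "(\<Sum>i<N. (Suc p choose Suc (2 * i)) * f i) = (\<Sum>i<M. (Suc p choose Suc (2 * i)) * f i)" for f
    using M by simp
  have AB: "A (Suc q) s = A q s + B q s" for q s
    by (simp add: A_def B_def sum.distrib[symmetric] algebra_simps)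
  have BA: "B (Suc p) s = B p s + (\<Sum>i<N. (Suc p choose Suc (2 * i)) * (Suc i choose s))" for s
    unfolding * unfolding B_def M(1) sum.lessThan_Suc_shift
    by (simp add: sum.distrib[symmetric] algebra_simps)
  have IH: "A p s = ((p - s) choose s) * 2 ^ (p - 2 * s)"
    "A (Suc p) s = ((Suc p - s) choose s) * 2 ^ (Suc p - 2 * s)" for s
    unfolding A_def using ge2 by auto
  have "A (Suc (Suc p)) r = ((Suc (Suc p) - r) choose r) * 2 ^ (Suc (Suc p) - 2 * r)"
  proof (cases r)
    case 0
    have "A (Suc (Suc p)) 0 = 2 * A (Suc p) 0"
      unfolding AB[of "Suc p"] BA by (simp add: AB) (simp add: A_def)
    with 0 IH(2)[of 0] show ?thesis
      by simp
  next
    case (Suc s)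
    \<comment> \<open>\<open>Suc i choose Suc s\<close> splits into \<open>i choose s\<close>,
      giving \<open>A p s\<close>, and \<open>i choose Suc s\<close>, giving
      \<open>A p (Suc s)\<close>, which joins \<open>B p (Suc s)\<close> to form a second
      \<open>A (Suc p) (Suc s)\<close>.\<close>
    have rec: "A (Suc (Suc p)) (Suc s) = 2 * A (Suc p) (Suc s) + A p s"
      unfolding AB[of "Suc p"] BA
      by (simp add: AB) (simp add: A_def sum.distrib[symmetric] algebra_simps)
    \<comment> \<open>Below \<open>p = 2 * s\<close> all three binomials vanish, at it only the
      first does; above it the exponents are true differences and Pascal's rule applies.\<close>
    consider "p < 2 * s" | "p = 2 * s" | d where "p = 2 * s + Suc d"
      by (metis less_imp_Suc_add linorder_neqE_nat add_Suc_right)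
    then have "2 * ((Suc p - Suc s choose Suc s) * 2 ^ (Suc p - 2 * Suc s)) +
        (p - s choose s) * 2 ^ (p - 2 * s) =
        (Suc (Suc p) - Suc s choose Suc s) * 2 ^ (Suc (Suc p) - 2 * Suc s)"
    proof cases
      case 1
      then show ?thesis
        by (cases "s \<le> p") (auto simp: binomial_eq_0 Suc_diff_le not_le)
    next
      case 2
      then show ?thesis
        by (simp add: binomial_eq_0 Suc_diff_le)
    next
      case (3 d)
      then have "p - s = s + Suc d"
        by simp
      with 3 show ?thesis
        by (simp add: Suc_diff_le algebra_simps)
    qed
    then show ?thesis
      unfolding Suc rec IH .
  qed
  then show ?case
    by (simp only: A_def)
qed

text \<open>Raising \<open>n\<close> adds, by Pascal's rule, the odd-index sum for
  \<open>p = n + r\<close>, whose value \<open>(n choose r) * 2 ^ (n - r)\<close> is exactly the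
  increment of \<open>U\<close>.\<close>

lemma sum_choose_even_mult_choose:
  assumes "r < n" and "n + Suc r \<le> Suc (2 * N)"
  shows "(\<Sum>i<N. ((n + Suc r) choose (2 * i + 2)) * (i choose r)) = (\<Sum>i<n. (i choose r) * 2 ^ (i - r))"
  using assms
proof (induction n)
  case (Suc n)
  have step: "(\<Sum>i<N. (Suc (n + Suc r) choose (2 * i + 2)) * (i choose r)) =
      (\<Sum>i<N. ((n + Suc r) choose (2 * i + 2)) * (i choose r)) +
      (\<Sum>i<N. (Suc (n + r) choose Suc (2 * i)) * (i choose r))"
    by (simp add: sum.distrib[symmetric] algebra_simps)
  have odd: "(\<Sum>i<N. (Suc (n + r) choose Suc (2 * i)) * (i choose r)) = (n choose r) * 2 ^ (n - r)"
    using sum_choose_odd_mult_choose[of "n + r" N r] Suc.prems by simp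
  show ?case
  proof (cases "r = n")
    case True
    \<comment> \<open>The induction really starts here: \<open>2 * i + 2 \<le> 2 * r + 1\<close>
      forces \<open>i < r\<close>, so every term vanishes.\<close>
    have "(\<Sum>i<N. ((n + Suc r) choose (2 * i + 2)) * (i choose r)) = 0"
      using True by (auto simp: binomial_eq_0_iff)
    moreover have "(\<Sum>i<n. (i choose r) * 2 ^ (i - r)) = 0"
      using True by auto
    ultimately show ?thesis
      by (simp only: add_Suc step odd sum.lessThan_Suc)
  next
    case False
    with Suc.prems have "(\<Sum>i<N. ((n + Suc r) choose (2 * i + 2)) * (i choose r)) =
        (\<Sum>i<n. (i choose r) * 2 ^ (i - r))"
      by (intro Suc.IH) auto
    then show ?thesis
      by (simp only: add_Suc step odd sum.lessThan_Suc)
  qed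
qed simp

section \<open>The increments of \<open>V\<close> for positive \<open>r\<close>\<close>

text \<open>The left side is \<open>V\<close> for \<open>r = Suc b\<close> and
  \<open>n = Suc b + q\<close>, summed in reverse. Raising \<open>q\<close> adds
  \<open>2 ^ q\<close> times a hockey-stick sum.\<close>

lemma sum_choose_mult_power_diff:
  "(\<Sum>i<q. real ((b + i) choose b) * (2 ^ q - 2 ^ i)) =
    (\<Sum>i<Suc b + q. real (i choose Suc b) * 2 ^ (i - Suc b))"
proof (induction q)
  case 0
  show ?case
    by (simp add: sum.neutral del: sum.lessThan_Suc)
next
  case (Suc q)
  have "(\<Sum>i<Suc q. real ((b + i) choose b) * (2 ^ Suc q - 2 ^ i)) =
      (\<Sum>i<q. real ((b + i) choose b) * (2 ^ q - 2 ^ i)) + real (\<Sum>i\<le>q. (b + i) choose b) * 2 ^ q"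
    unfolding of_nat_sum sum_distrib_right lessThan_Suc_atMost[symmetric] sum.lessThan_Suc
    by (simp add: sum.distrib[symmetric] sum_distrib_left algebra_simps)
  also have "(\<Sum>i\<le>q. (b + i) choose b) = (Suc b + q) choose Suc b"
    by (induction q) auto
  finally show ?case
    using Suc by simp
qed

section \<open>The recurrence in \<open>r\<close> shared by \<open>U\<close> and
  \<open>W\<close>\<close>

text \<open>By Pascal's rule the two summands at \<open>i\<close> add up to the increment of the
  right side from \<open>n = i\<close> to \<open>n = Suc i\<close>.\<close>

lemma sum_choose_mult_power_add:
  "(\<Sum>i<n. (i choose Suc r) * 2 ^ (i - Suc r)) + (\<Sum>i<n. (i choose r) * 2 ^ (i - r)) =
    (n choose Suc r) * (2 ^ (n - Suc r) :: nat)"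
proof (induction n)
  case (Suc n)
  consider "n < r" | "n = r" | d where "n = r + Suc d"
    by (metis less_imp_Suc_add linorder_neqE_nat add_Suc_right)
  then show ?case
    using Suc by cases (simp_all add: algebra_simps)
qed simp

lemma gbinomial_Suc_Suc_twice:
  "((x :: real) gchoose Suc (Suc k)) + 2 * (x gchoose Suc k) + (x gchoose k) = (x + 2 gchoose Suc (Suc k))"
  using gbinomial_Suc_Suc[of "x + 1" "Suc k"] gbinomial_Suc_Suc[of x "Suc k"] gbinomial_Suc_Suc[of x k]
  by (simp add: add.assoc)

lemma sum_gbinomial_even_shift:
  fixes x :: real
  defines "F \<equiv> \<lambda>x a. \<Sum>k\<le>a div 2. (x - 2 * real k) gchoose (a - 2 * k)"
  shows "F x (Suc a) + 2 * F x a = (x + 2 gchoose Suc a)"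
proof -
  have F: "F x (Suc (Suc a)) = (x gchoose Suc (Suc a)) + F (x - 2) a" for x a
    by (simp add: F_def sum.atMost_Suc_shift algebra_simps del: sum.atMost_Suc)
  have F01: "F x 0 = 1" "F x (Suc 0) = x" for x
    by (simp_all add: F_def)
  show ?thesis
  proof (induction a arbitrary: x rule: induct_nat_012)
    case 0
    show ?case
      by (simp add: F01)
  next
    case 1
    show ?case
      using gbinomial_Suc_Suc_twice[of x 0] by (simp add: F F01)
  next
    case (ge2 a)
    show ?case
      using ge2(1)[of "x - 2"] gbinomial_Suc_Suc_twice[of x "Suc a"] by (simp add: F)
  qed
qed

lemma sum_choose_mult_power_eq:
  assumes "r < n"
  shows "(\<Sum>i<n. real (i choose r) * 2 ^ (i - r)) =
    2 ^ (n - r) * (\<Sum>k\<le>r div 2. (real n - 2 - 2 * real k) gchoose (r - 2 * k)) + (- 1) ^ Suc r"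
  using assms
proof (induction r)
  case 0
  have "(\<Sum>i<n. (2::real) ^ i) = 2 ^ n - 1"
    by (induction n) auto
  then show ?case
    by simp
next
  case (Suc r)
  define F where "F a = (\<Sum>k\<le>a div 2. (real n - 2 - 2 * real k) gchoose (a - 2 * k))" for a
  have rec: "F (Suc r) + 2 * F r = real (n choose Suc r)"
    using sum_gbinomial_even_shift[of "real n - 2" r] by (simp add: F_def binomial_gbinomial)
  have pow: "(2::real) ^ (n - r) = 2 * 2 ^ (n - Suc r)"
    using Suc.prems by (metis Suc_diff_Suc Suc_lessD power_Suc)
  have "(\<Sum>i<n. real (i choose r) * 2 ^ (i - r)) = 2 ^ (n - r) * F r + (- 1) ^ Suc r"
    using Suc by (simp add: F_def)
  moreover have "(\<Sum>i<n. real (i choose Suc r) * 2 ^ (i - Suc r)) + (\<Sum>i<n. real (i choose r) * 2 ^ (i - r)) =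
      real (n choose Suc r) * 2 ^ (n - Suc r)"
    using arg_cong[OF sum_choose_mult_power_add[where n = n and r = r], of real] by simp
  ultimately have "(\<Sum>i<n. real (i choose Suc r) * 2 ^ (i - Suc r)) =
      2 ^ (n - Suc r) * F (Suc r) + (- 1) ^ Suc (Suc r)"
    unfolding rec[symmetric] pow by (simp add: algebra_simps)
  then show ?case
    by (simp only: F_def)
qed

lemma ibinom_of_nat: "ibinom (int n) (int k) = real (n choose k)"
  by (simp add: ibinom_def binomial_gbinomial)

lemma sum_int_atLeastAtMost_shift:
  fixes f :: "int \<Rightarrow> real"
  assumes "\<And>i. a \<le> i \<Longrightarrow> i < n \<Longrightarrow> f (int i + 1) = g i" and "\<And>i. i < a \<Longrightarrow> g i = 0"
  shows "sum f {int a + 1..int n} = sum g {..<n}"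
proof -
  have "sum f {int a + 1..int n} = sum g {a..<n}"
    by (rule sum.reindex_bij_witness[where i = "\<lambda>i. int i + 1" and j = "\<lambda>j. nat (j - 1)"])
      (auto simp: assms(1)[symmetric])
  also have "\<dots> = sum g {..<n}"
    by (rule sum.mono_neutral_left) (auto simp: assms(2))
  finally show ?thesis .
qed

lemma S_sum_of_nat:
  "S_sum (int n) (int r) = real (\<Sum>i<n div 2. (n choose (2 * i + 2)) * (i choose r))"
proof -
  have *: "\<lfloor>real_of_int (int n) / 2\<rfloor> = int (n div 2)"
    by linarith
  have "ibinom (int n) (2 * (int i + 1)) = real (n choose (2 * i + 2))" for i
    using ibinom_of_nat[of n "2 * i + 2"] by (simp add: algebra_simps)
  then show ?thesis
    unfolding S_sum_def * of_nat_sum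
    by (intro sum_int_atLeastAtMost_shift) (auto simp: ibinom_of_nat)
qed

lemma T_sum_of_nat:
  "T_sum (int n) (int r) = real (\<Sum>i<n. (n choose Suc i) * (i choose r))"
proof -
  have "ibinom (int n) (int i + 1) = real (n choose Suc i)" for i
    using ibinom_of_nat[of n "Suc i"] by (simp add: algebra_simps)
  then show ?thesis
    unfolding T_sum_def of_nat_sum
    by (intro sum_int_atLeastAtMost_shift) (auto simp: ibinom_of_nat)
qed

lemma U_sum_of_nat:
  "U_sum (int n) (int r) = real (\<Sum>i<n. (i choose r) * 2 ^ (i - r))"
  unfolding U_sum_def of_nat_sum
  by (intro sum_int_atLeastAtMost_shift)
    (auto simp: ibinom_of_nat power_int_def nat_diff_distrib)

lemma V_sum_0: "0 < n \<Longrightarrow> V_sum (int n) 0 = 2 ^ n - 1"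
proof -
  assume "0 < n"
  have "ibinom (int n - 1 - j) (- 1) = (if j = int n then 1 else 0)" if "j \<le> int n" for j
  proof (cases "j = int n")
    case False
    define k where "k = nat (int n - 1 - j)"
    have "int n - 1 - j = int k" "int k - (- 1) = int (Suc k)"
      using False that by (auto simp: k_def)
    then show ?thesis
      using False by (simp add: ibinom_def binomial_gbinomial[symmetric] nat_add_distrib)
  qed (simp add: ibinom_def)
  then have "V_sum (int n) 0 = (\<Sum>j = 1..int n. if j = int n then 2 ^ n - 1 else 0)"
    unfolding V_sum_def by (intro sum.cong) auto
  with \<open>0 < n\<close> show ?thesis
    by simp
qed

lemma V_sum_Suc:
  "V_sum (int (Suc b + q)) (int (Suc b)) = (\<Sum>i<q. real ((b + i) choose b) * (2 ^ q - 2 ^ i))"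
proof -
  have "V_sum (int (Suc b + q)) (int (Suc b)) =
      (\<Sum>i<q. real ((b + (q - Suc i)) choose b) * (2 ^ q - 2 ^ (q - Suc i)))"
  proof -
    have "ibinom (int (Suc b + q) - 1 - (int i + 1)) (int (Suc b) - 1) *
        2 powi (int (Suc b + q) - int (Suc b) - (int i + 1)) * (2 powi (int i + 1) - 1) =
        real ((b + (q - Suc i)) choose b) * (2 ^ q - 2 ^ (q - Suc i))" if i: "i < q" for i
    proof -
      obtain d where d: "q = Suc i + d"
        using less_imp_Suc_add[OF i] by auto
      have eqs: "int (Suc b + q) - 1 - (int i + 1) = int (b + d)" "int (Suc b) - 1 = int b"
        "int (Suc b + q) - int (Suc b) - (int i + 1) = int d" "int i + 1 = int (Suc i)"
        using d by auto
      have "q - Suc i = d"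
        using d by simp
      then show ?thesis
        unfolding eqs(1-3) unfolding eqs(4) ibinom_of_nat power_int_of_nat
        by (simp add: d power_add algebra_simps)
    qed
    then show ?thesis
      unfolding V_sum_def
      using sum_int_atLeastAtMost_shift[where a = 0 and n = q] by simp
  qed
  also have "\<dots> = (\<Sum>i<q. real ((b + i) choose b) * (2 ^ q - 2 ^ i))"
    by (rule sum.nat_diff_reindex)
  finally show ?thesis .
qed

lemma W_sum_of_nat:
  assumes "r < n"
  shows "W_sum (int n) (int r) =
    2 ^ (n - r) * (\<Sum>k\<le>r div 2. (real n - 2 - 2 * real k) gchoose (r - 2 * k)) + (- 1) ^ Suc r"
proof -
  have *: "\<lfloor>real_of_int (int r) / 2\<rfloor> = int (r div 2)"
    by linarith
  have "(\<Sum>k = 0..int (r div 2). ibinom (int n - 2 - 2 * k) (int r - 2 * k)) =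
      (\<Sum>k\<le>r div 2. (real n - 2 - 2 * real k) gchoose (r - 2 * k))"
    by (rule sum.reindex_bij_witness[where i = int and j = nat])
      (auto simp: ibinom_def nat_diff_distrib nat_mult_distrib)
  moreover have "int n - int r = int (n - r)" "int r + 1 = int (Suc r)"
    using assms by auto
  ultimately show ?thesis
    unfolding W_sum_def * by (simp only: power_int_of_nat)
qed

theorem theorem1p1:
  fixes m r :: int
  assumes "0 \<le> r" and "real_of_int r \<le> real_of_int m / 2 - 1"
  shows "S_sum m r = T_sum (m - 1 - r) r
       \<and> T_sum (m - 1 - r) r = U_sum (m - 1 - r) r
       \<and> U_sum (m - 1 - r) r = V_sum (m - 1 - r) r
       \<and> V_sum (m - 1 - r) r = W_sum (m - 1 - r) r"
proof -
  obtain a where a: "r = int a"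
    using assms(1) nonneg_int_cases by blast
  have "2 * r + 2 \<le> m"
    using assms(2) by linarith
  then obtain n where n: "m = int (n + Suc a)" "a < n"
    using a by (intro that[of "nat (m - 1 - r)"]) auto
  have m: "m - 1 - r = int n"
    using n a by simp
  have S: "S_sum m r = U_sum (int n) r"
    unfolding n(1) a S_sum_of_nat U_sum_of_nat
    using n(2) by (subst sum_choose_even_mult_choose) auto
  have T: "T_sum (int n) r = U_sum (int n) r"
    unfolding a T_sum_of_nat U_sum_of_nat sum_choose_Suc_mult_choose ..
  have W: "U_sum (int n) r = W_sum (int n) r"
    unfolding a U_sum_of_nat W_sum_of_nat[OF n(2)] sum_choose_mult_power_eq[OF n(2), symmetric]
    by simp
  have V: "U_sum (int n) r = V_sum (int n) r"
  proof (cases a)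
    case 0
    have "(\<Sum>i<n. (2::real) ^ i) = 2 ^ n - 1"
      by (induction n) auto
    then show ?thesis
      using n(2) 0 U_sum_of_nat[of n 0] by (simp add: a V_sum_0)
  next
    case (Suc b)
    then obtain q where q: "n = Suc b + q"
      using n(2) by (metis less_imp_add_positive)
    show ?thesis
      unfolding a Suc q U_sum_of_nat V_sum_Suc sum_choose_mult_power_diff by simp
  qed
  from S T V W show ?thesis
    unfolding m by simp
qed

end
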